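(* Let $R$ be a finite commutative ring with unity and let $\Gamma'(R)$ be the unity product graph associated with $R$. Then the following hold: (1) $diam(\Gamma'(R))=\infty$; (2) $rad(\Gamma'(R))=\infty$.
   Context: For a ring $R$ with unity $e$, let $U(R)$ denote the set of units of $R$. The unity product graph $\Gamma'(R)$ is the simple graph with vertex set $U(R)$ in which two distinct vertices $r_i,r_j$ are adjacent if and only if $r_i\cdot r_j=e$. The distance between two vertices is the length of a shortest path between them, and is $\infty$ if there is no path. The eccentricity of a vertex is the maximum of its distances to all other vertices; the diameter $diam(\Gamma)$ is the maximum, and the radius $rad(\Gamma)$ the minimum, of the eccentricities of all vertices of $\Gamma$.
   Formalization: The formal statement additionally assumes that R has a unit other than e; if U(R) = {e} (for example R = F_2), the graph is a single vertex with diameter and radius 0 (or undefined), so the claim fails there. *)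

theory Defs
  imports
    "HOL-Algebra.Ring"
    "HOL-Library.Extended_Nat"
    "Graph_Theory.Graph_Theory"
begin

text \<open>
  Graph distances take values in \<^typ>\<open>enat\<close>, with the infimum over the empty set of
  paths being \<open>\<infinity>\<close>.  The library's \<open>apath\<close> is a walk without repeated vertices, given by
  its list of arcs, so \<open>length\<close> counts edges.
\<close>

definition graph_dist :: "('a, 'b) pre_digraph \<Rightarrow> 'a \<Rightarrow> 'a \<Rightarrow> enat" where
  "graph_dist G u v = (INF p \<in> {p. pre_digraph.apath G u p v}. enat (length p))"

text \<open>
  For finite graphs the following suprema and infima are maxima and minima, except that the
  eccentricity in a one-vertex graph is the supremum of the empty set, which is \<open>0\<close>.
\<close>

definition eccentricity :: "('a, 'b) pre_digraph \<Rightarrow> 'a \<Rightarrow> enat" where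
  "eccentricity G u = (SUP v \<in> verts G - {u}. graph_dist G u v)"

definition graph_diam :: "('a, 'b) pre_digraph \<Rightarrow> enat" where
  "graph_diam G = (SUP u \<in> verts G. eccentricity G u)"

definition graph_rad :: "('a, 'b) pre_digraph \<Rightarrow> enat" where
  "graph_rad G = (INF u \<in> verts G. eccentricity G u)"

text \<open>
  Each undirected edge is represented by two opposite arcs, as usual for the library's simple
  graphs (\<open>pair_graph\<close>).
\<close>

definition unity_product_graph :: "('a, 'm) ring_scheme \<Rightarrow> 'a pair_pre_digraph" where
  "unity_product_graph R =
     \<lparr> pverts = Units R,
       parcs = {(r, s). r \<in> Units R \<and> s \<in> Units R \<and> r \<noteq> s \<and> r \<otimes>\<^bsub>R\<^esub> s = \<one>\<^bsub>R\<^esub>} \<rparr>"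

lemma pair_graph_unity_product_graph:
  assumes "cring R" and "finite (carrier R)"
  shows "pair_graph (unity_product_graph R)"
proof -
  interpret cring R by fact
  have fin: "finite (Units R)"
    by (rule finite_subset[OF Units_closed[THEN subsetI] assms(2)])
  have "finite (parcs (unity_product_graph R))"
    by (rule finite_subset[of _ "Units R \<times> Units R"])
      (use fin in \<open>auto simp: unity_product_graph_def\<close>)
  moreover have "symmetric (with_proj (unity_product_graph R))"
    by (auto simp: symmetric_def sym_def unity_product_graph_def m_comm Units_closed)
  ultimately show ?thesis
    using fin by unfold_locales (auto simp: unity_product_graph_def)
qed

text \<open>
  If the one of the ring is its only unit (for instance in the field with two elements), the
  graph is a single vertex and has diameter and radius \<open>0\<close>.  Results asserting infinite
  diameter or radius must therefore exclude this case.
\<close>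

lemma graph_diam_rad_trivial_units:
  assumes "Units R = {\<one>\<^bsub>R\<^esub>}"
  shows "graph_diam (with_proj (unity_product_graph R)) = 0"
    and "graph_rad (with_proj (unity_product_graph R)) = 0"
  using assms
  by (simp_all add: graph_diam_def graph_rad_def eccentricity_def unity_product_graph_def
      bot_enat_def)

end

theory Submission
  imports Defs
begin

text \<open>
  The unity is an isolated vertex of the unity product graph: if \<open>r \<otimes> \<one> = \<one>\<close> or
  \<open>\<one> \<otimes> r = \<one>\<close>, then \<open>r = \<one>\<close>, and the graph has no loops.  Hence \<open>\<one>\<close> is at infinite
  distance from every other unit, in both directions.  As soon as there is a second unit, every
  vertex \<open>u\<close> has infinite eccentricity: for \<open>u \<noteq> \<one>\<close> the vertex \<open>\<one>\<close> is infinitely far away,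
  and for \<open>u = \<one>\<close> any other unit is.  The diameter and the radius are then the supremum and
  the infimum of a nonempty family that is constantly \<open>\<infinity>\<close>.
\<close>

text \<open>
  A walk between distinct vertices has at least one arc, so its first arc leaves the start and
  its last arc enters the end; neither exists at an isolated vertex.
\<close>

lemma graph_dist_isolated:
  assumes isolated: "\<And>a. a \<in> arcs G \<Longrightarrow> tail G a \<noteq> w \<and> head G a \<noteq> w"
    and "u \<noteq> v" and "u = w \<or> v = w"
  shows "graph_dist G u v = \<infinity>"
proof -
  have ends: "p = [] \<and> u = v \<or> p \<noteq> [] \<and> tail G (hd p) = u \<and> head G (last p) = v"
    if "pre_digraph.cas G u p v" for u p v
    using that
    by (induction p arbitrary: u) (fastforce simp: pre_digraph.cas.simps)+
  have "\<not> pre_digraph.apath G u p v" for p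
  proof
    assume "pre_digraph.apath G u p v"
    then have arcs: "set p \<subseteq> arcs G" and cas: "pre_digraph.cas G u p v"
      by (auto simp: pre_digraph.apath_def pre_digraph.awalk_def)
    from ends[OF cas] \<open>u \<noteq> v\<close>
    have "p \<noteq> []" and "tail G (hd p) = u" and "head G (last p) = v"
      by auto
    moreover from \<open>p \<noteq> []\<close> arcs have "hd p \<in> arcs G" and "last p \<in> arcs G"
      by auto
    ultimately show False
      using isolated assms(3) by blast
  qed
  then show ?thesis
    by (simp add: graph_dist_def top_enat_def)
qed

lemma (in ring) graph_dist_one_unity_product_graph:
  assumes "u \<noteq> v" and "u = \<one> \<or> v = \<one>"
  shows "graph_dist (with_proj (unity_product_graph R)) u v = \<infinity>"
  using _ assms
  by (rule graph_dist_isolated) (auto simp: unity_product_graph_def Units_closed)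

lemma (in ring) eccentricity_unity_product_graph:
  assumes "Units R \<noteq> {\<one>}" and "u \<in> Units R"
  shows "eccentricity (with_proj (unity_product_graph R)) u = \<infinity>"
proof -
  obtain v where v: "v \<in> Units R - {u}" and one: "u = \<one> \<or> v = \<one>"
    using assms by (cases "u = \<one>") auto
  then have "graph_dist (with_proj (unity_product_graph R)) u v = \<infinity>"
    by (intro graph_dist_one_unity_product_graph) auto
  moreover have "graph_dist (with_proj (unity_product_graph R)) u v
      \<le> eccentricity (with_proj (unity_product_graph R)) u"
    unfolding eccentricity_def
    by (rule SUP_upper) (use v in \<open>simp add: unity_product_graph_def\<close>)
  ultimately show ?thesis
    by simp
qed

theorem theorem4p4:
  fixes R :: "('a, 'm) ring_scheme"
  assumes "cring R" and "finite (carrier R)"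
    and "Units R \<noteq> {\<one>\<^bsub>R\<^esub>}"
  shows "graph_diam (with_proj (unity_product_graph R)) = \<infinity> \<and>
         graph_rad (with_proj (unity_product_graph R)) = \<infinity>"
proof -
  interpret cring R by fact
  let ?G = "with_proj (unity_product_graph R)"
  have ecc: "eccentricity ?G u = \<infinity>" if "u \<in> verts ?G" for u
    using that assms(3)
    by (intro eccentricity_unity_product_graph) (simp_all add: unity_product_graph_def)
  have nonempty: "verts ?G \<noteq> {}"
    using Units_one_closed by (auto simp: unity_product_graph_def)
  have "graph_diam ?G = \<infinity>"
    unfolding graph_diam_def using nonempty by (simp add: ecc cong: SUP_cong)
  moreover have "graph_rad ?G = \<infinity>"
    unfolding graph_rad_def using nonempty by (simp add: ecc cong: INF_cong)
  ultimately show ?thesis ..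
qed

end
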